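(* Let $G=(V,E)$ be a finite connected closed metric graph (no exterior vertices) with edge lengths $\ell\in(0,\infty)^E$, standard Kirchhoff conditions at every vertex, and $\beta_1(G)=|E|-|V|+1=2$. If $r$ is the edge-energy vector of a regular secular state on $G$, then $$r\in\mathcal M_G^{\mathrm{bc}}.$$ More precisely, there exist finitely many real vectors $A^{(j)}\in\mathbb R^E$, each belonging to the kernel of one of the joint closure-sector matrices $B_{(\varepsilon_1,\varepsilon_2)}$, $(\varepsilon_1,\varepsilon_2)\in\{\pm1\}^2$, such that $$r=\sum_j\bigl(A^{(j)}\bigr)^{\circ2}.$$ Consequently, for every $\alpha\in[0,\infty)^E$, $$\frac{\alpha\cdot r}{\ell\cdot r}\ge C_{\mathrm{sing}}(\alpha;\ell).$$
   Context: **Graphs.** $G$ may have loops and multiple edges; every vertex has degree at least two and is internal (degree-one vertices would be exterior). Orient the edges. **Singular cone.** A singular sector $\sigma$ assigns to each edge a parity $\sigma_e=\cos\theta_e\in\{\pm1\}$, $\theta_e\in\pi\mathbb Z$. $B_{\sigma,\mathrm{bc}}\in\mathbb R^{V\times E}$ has: for a non-loop edge from $v_-$ to $v_+$, entries $1$ in row $v_-$ and $-\sigma_e$ in row $v_+$; for a loop at $v$, entry $1-\sigma_e$ in row $v$; all other entries zero. With $A^{\circ2}=(A_e^2)_e$, $\mathcal M_G^{\mathrm{bc}}$ is the convex cone generated by $\bigcup_\sigma\{A^{\circ2}:A\in\ker B_{\sigma,\mathrm{bc}}\}$. $$C_{\mathrm{sing}}(\alpha;\ell)=\min_\sigma\ \inf_{0\ne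 A\in\ker B_{\sigma,\mathrm{bc}}}\frac{\sum_e\alpha_eA_e^2}{\sum_e\ell_eA_e^2}$$ (sectors with trivial kernel omitted). **Joint closure sectors.** Fix a spanning tree $T$ of $G$, with complementary chords $e_1,e_2$. $B_{(\varepsilon_1,\varepsilon_2)}$ is the matrix $B_{\sigma,\mathrm{bc}}$ with $\sigma_e=+1$ (ordinary oriented incidence) for $e\in T$ and $\sigma_{e_i}=\varepsilon_i$, $i=1,2$. **Regular secular states.** A regular secular state at a phase vector $\theta\in(\mathbb R/2\pi\mathbb Z)^E$ consists of real vertex values $\phi_v$ ($v\in V$) and real normalized outward derivatives $p_{v,e}$, one for each incidence of an edge with a vertex (two for a loop), not all zero, such that: at each vertex the $p_{v,e}$ over all incidences sum to $0$; for each edge $e=vw$, $\theta_e\notin\pi\mathbb Z$, $\phi_w=\phi_v\cos\theta_e+p_{v,e}\sin\theta_e$ and $-p_{w,e}=-\phi_v\sin\theta_e+p_{v,e}\cos\theta_e$. Its edge-energy vector is $r_e=\phi_v^2+p_{v,e}^2$ (the same at both endpoints); it equals $|A_e|^2+|B_e|^2$ for $u_e(x)=A_e\cos kx+B_e\sin kx$, $k\ell_e\equiv\theta_e$. *)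

theory Defs
  imports "HOL-Analysis.Analysis" "Graph_Theory.Digraph_Component"
begin

text \<open>
  An oriented finite multigraph with loops is a \<^typ>\<open>('v::finite, 'e::finite) pre_digraph\<close>
  with \<open>verts G = UNIV\<close> and \<open>arcs G = UNIV\<close>; the arc \<open>e\<close> runs from
  \<open>v\<^sub>- = tail G e\<close> to \<open>v\<^sub>+ = head G e\<close>. Then \<open>\<real>\<^sup>V\<close> is \<open>real ^ 'v\<close> and \<open>\<real>\<^sup>E\<close> is \<open>real ^ 'e\<close>.
  Graph connectivity is written \<open>Digraph_Component.connected\<close>, which ignores orientations, to
  distinguish it from topological connectedness.
\<close>

definition vertex_degree :: "('v, 'e) pre_digraph \<Rightarrow> 'v \<Rightarrow> nat" where
  "vertex_degree G v = in_degree G v + out_degree G v"  \<comment> \<open>a loop counts twice\<close>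

definition betti1 :: "('v, 'e) pre_digraph \<Rightarrow> int" where
  "betti1 G = int (card (arcs G)) - int (card (verts G)) + 1"


subsection \<open>Spanning trees\<close>

text \<open>
  The predicates \<open>forest\<close> and \<open>tree\<close> of the graph library exclude directed cycles only, which
  is too weak for an arbitrarily oriented graph. Here the edges of a cycle may be traversed in either
  direction. A loop is a cycle of length 1, two parallel edges form a cycle of length 2.
\<close>

definition undirected_cycle :: "('v, 'e) pre_digraph \<Rightarrow> 'v list \<Rightarrow> 'e list \<Rightarrow> bool" where
  "undirected_cycle H vs es \<longleftrightarrow>
     es \<noteq> [] \<and> length vs = length es \<and> distinct vs \<and> distinct es \<and> set es \<subseteq> arcs H \<and>
     (\<forall>i < length es. {tail H (es ! i), head H (es ! i)} = {vs ! i, vs ! (Suc i mod length es)})"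

definition undirected_spanning_tree ::
    "('v, 'e) pre_digraph \<Rightarrow> ('v, 'e) pre_digraph \<Rightarrow> bool" where
  "undirected_spanning_tree T G \<longleftrightarrow>
     spanning T G \<and> Digraph_Component.connected T \<and> (\<nexists>vs es. undirected_cycle T vs es)"


subsection \<open>Singular sectors and the singular cone\<close>

text \<open>A sector \<open>\<sigma>\<close> is given by its parities \<open>\<sigma> e = cos \<theta>\<^sub>e\<close>, \<open>\<theta>\<^sub>e \<in> \<pi>\<int>\<close>.\<close>

definition sectors :: "('e \<Rightarrow> real) set" where
  "sectors = {\<sigma>. \<forall>e. \<sigma> e \<in> {1, -1}}"

definition B_bc :: "('v::finite, 'e::finite) pre_digraph \<Rightarrow> ('e \<Rightarrow> real) \<Rightarrow> real ^ 'e ^ 'v" where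
  "B_bc G \<sigma> = (\<chi> v e.
     if tail G e = head G e then (if v = tail G e then 1 - \<sigma> e else 0)
     else if v = tail G e then 1
     else if v = head G e then - \<sigma> e
     else 0)"

definition ker_bc :: "('v::finite, 'e::finite) pre_digraph \<Rightarrow> ('e \<Rightarrow> real) \<Rightarrow> (real ^ 'e) set" where
  "ker_bc G \<sigma> = {A. B_bc G \<sigma> *v A = 0}"

definition sq :: "real ^ 'e \<Rightarrow> real ^ 'e" where
  "sq A = (\<chi> e. (A $ e)\<^sup>2)"

definition M_bc :: "('v::finite, 'e::finite) pre_digraph \<Rightarrow> (real ^ 'e) set" where
  "M_bc G = convex_cone hull (\<Union>\<sigma>\<in>sectors. sq ` ker_bc G \<sigma>)"

text \<open>
  The minimum is over a finite set, which is nonempty as soon as \<open>G\<close> has a cycle, since the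
  kernel of the sector \<open>\<sigma> = 1\<close> is the cycle space. For \<open>len > 0\<close> the quotients are bounded below by
  the least \<open>\<alpha>\<^sub>e / len\<^sub>e\<close>, so the infimum is a genuine one.
\<close>

definition C_sing ::
    "('v::finite, 'e::finite) pre_digraph \<Rightarrow> real ^ 'e \<Rightarrow> real ^ 'e \<Rightarrow> real" where
  "C_sing G \<alpha> len =
     Min ((\<lambda>\<sigma>. INF A \<in> ker_bc G \<sigma> - {0}.
                 (\<Sum>e\<in>UNIV. \<alpha> $ e * (A $ e)\<^sup>2) / (\<Sum>e\<in>UNIV. len $ e * (A $ e)\<^sup>2))
          ` {\<sigma> \<in> sectors. ker_bc G \<sigma> \<noteq> {0}})"

definition joint_parity :: "'e \<Rightarrow> 'e \<Rightarrow> real \<Rightarrow> real \<Rightarrow> 'e \<Rightarrow> real" where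
  "joint_parity e1 e2 \<epsilon>1 \<epsilon>2 = (\<lambda>_. 1)(e1 := \<epsilon>1, e2 := \<epsilon>2)"


subsection \<open>Regular secular states\<close>

text \<open>
  Phases are represented by real numbers; only their classes modulo \<open>2 * pi\<close> matter. The two
  incidences of an edge \<open>e\<close> are its tail end and its head end, with outward derivatives \<open>pt $ e\<close>
  and \<open>ph $ e\<close>. The transfer relations along \<open>e\<close> are invariant under exchanging the two ends.
\<close>

definition regular_secular_state ::
    "('v::finite, 'e::finite) pre_digraph \<Rightarrow> real ^ 'e \<Rightarrow>
     real ^ 'v \<Rightarrow> real ^ 'e \<Rightarrow> real ^ 'e \<Rightarrow> bool" where
  "regular_secular_state G \<theta> \<phi> pt ph \<longleftrightarrow>
     \<not> (\<phi> = 0 \<and> pt = 0 \<and> ph = 0) \<and>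
     (\<forall>v. (\<Sum>e\<in>out_arcs G v. pt $ e) + (\<Sum>e\<in>in_arcs G v. ph $ e) = 0) \<and>
     (\<forall>e. (\<nexists>k::int. \<theta> $ e = of_int k * pi) \<and>
        \<phi> $ head G e = \<phi> $ tail G e * cos (\<theta> $ e) + pt $ e * sin (\<theta> $ e) \<and>
        - (ph $ e) = - (\<phi> $ tail G e) * sin (\<theta> $ e) + pt $ e * cos (\<theta> $ e))"

definition edge_energy ::
    "('v::finite, 'e::finite) pre_digraph \<Rightarrow> real ^ 'v \<Rightarrow> real ^ 'e \<Rightarrow> real ^ 'e" where
  "edge_energy G \<phi> pt = (\<chi> e. (\<phi> $ tail G e)\<^sup>2 + (pt $ e)\<^sup>2)"

lemma edge_energy_head:
  assumes "regular_secular_state G \<theta> \<phi> pt ph"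
  shows "edge_energy G \<phi> pt $ e = (\<phi> $ head G e)\<^sup>2 + (ph $ e)\<^sup>2"
proof -
  let ?f = "\<phi> $ tail G e" and ?p = "pt $ e" and ?c = "cos (\<theta> $ e)" and ?s = "sin (\<theta> $ e)"
  have h: "\<phi> $ head G e = ?f * ?c + ?p * ?s" and p: "ph $ e = ?f * ?s - ?p * ?c"
    using assms unfolding regular_secular_state_def by (auto simp: algebra_simps dest!: spec[of _ e])
  have "(\<phi> $ head G e)\<^sup>2 + (ph $ e)\<^sup>2 = (?f\<^sup>2 + ?p\<^sup>2) * (?s\<^sup>2 + ?c\<^sup>2)"
    unfolding h p by algebra
  then show ?thesis
    by (simp add: edge_energy_def)
qed

end

theory Submission
  imports Defs
begin

text \<open>
  A secular state is compared with flows through what they have in common: its outward derivatives \<open>p\<close>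
  sum to zero at every vertex, and \<open>r\<^sub>e = \<phi>\<^sub>v\<^sup>2 + p\<^sub>v\<^sub>,\<^sub>e\<^sup>2\<close> at both ends of every edge. A vector in a sector
  kernel obeys the same rule: its outflows at the half-edges sum to zero at every vertex, and the
  squares of the outflows at the two ends of an edge agree. At a vertex of degree two, two numbers
  with sum zero differ only in sign, so \<open>r\<close>, and likewise the squares and products of flows, take the
  same value on edges in series. It is therefore enough to compare \<open>r\<close> with a sum of squares on one
  edge of each series class.

  The chords give three test vectors: flows \<open>A\<^sub>1\<close>, \<open>A\<^sub>2\<close> in the sector \<open>(1, 1)\<close> with chord values
  \<open>(1, 0)\<close> and \<open>(0, 1)\<close>, and \<open>D\<close> in the sector \<open>(-1, -1)\<close> with chord values \<open>(1, -1)\<close>. They exist because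
  the edges off the chords span all divergences of total zero (\<open>flow_with_chord_values\<close>).

  A count bounds the number of classes. First Betti number two means that the degrees exceed two by
  two in total, so there are either four half-edges at one branch vertex or three at each of two. A
  nonempty union of series classes has an even, positive number of half-edges at branch vertices
  (\<open>even_branch_halves\<close>, \<open>branch_halves_nonempty\<close>). Hence there are at most three classes, and if a
  class other than those of the chords exists, there are two vertices of degree three and every class
  has two of the six half-edges (\<open>three_series_classes\<close>). This leaves three cases.

  \<^item> Two classes, as in a figure eight: \<open>r = r\<^sub>1 A\<^sub>1\<^sup>2 + r\<^sub>2 A\<^sub>2\<^sup>2\<close>.
  \<^item> A branch vertex meets all three classes, as in a theta graph. Flows in the sector \<open>(1, 1)\<close> have squares
    \<open>(x\<^sup>2, y\<^sup>2, (x + y)\<^sup>2)\<close> on the classes, for arbitrary \<open>x\<close> and \<open>y\<close>. The derivatives at that vertex sum to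
    zero, so their squares have this form, and \<open>\<phi>\<^sup>2 (1, 1, 1)\<close> is a sum of two such triples.
  \<^item> Each branch vertex meets the third class once and a chord class twice, one vertex the class of \<open>e1\<close> and
    the other that of \<open>e2\<close>, as in a dumbbell. Then
    \<open>A\<^sub>1\<close> and \<open>A\<^sub>2\<close> vanish on the third class, and \<open>D\<^sup>2\<close> is \<open>1\<close>, \<open>1\<close>, \<open>4\<close> on the classes. At a branch vertex the
    derivative along the third class is minus the sum of two numbers of equal square, so
    \<open>r\<^sub>3 \<le> 4 r\<^sub>1\<close> and \<open>r\<^sub>3 \<le> 4 r\<^sub>2\<close>, and
    \<open>r = (r\<^sub>3 / 4) D\<^sup>2 + (r\<^sub>1 - r\<^sub>3 / 4) A\<^sub>1\<^sup>2 + (r\<^sub>2 - r\<^sub>3 / 4) A\<^sub>2\<^sup>2\<close>.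

  The bound on the quotient holds for every nonzero vector of the cone: the condition
  \<open>C (len \<bullet> r) \<le> \<alpha> \<bullet> r\<close> is linear in \<open>r\<close> and holds on the generators by the definition of \<open>C\<close>.
\<close>


section \<open>Half-edges and divergence\<close>

text \<open>
  A half-edge is a pair of an edge and a flag, true at the tail and false at the head. A loop thus has
  two half-edges at its vertex, and the degree of a vertex is the number of half-edges in its star.
\<close>

definition origin :: "('v, 'e) pre_digraph \<Rightarrow> 'e \<times> bool \<Rightarrow> 'v" where
  "origin G h = (if snd h then tail G (fst h) else head G (fst h))"

definition star :: "('v, 'e) pre_digraph \<Rightarrow> 'v \<Rightarrow> ('e \<times> bool) set" where
  "star G v = {h. origin G h = v}"

definition balanced :: "('v, 'e) pre_digraph \<Rightarrow> ('e \<times> bool \<Rightarrow> real) \<Rightarrow> bool" where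
  "balanced G f \<longleftrightarrow> (\<forall>v. (\<Sum>h\<in>star G v. f h) = 0)"

definition outflow :: "('e \<Rightarrow> real) \<Rightarrow> real ^ 'e \<Rightarrow> 'e \<times> bool \<Rightarrow> real" where
  "outflow \<sigma> A h = (if snd h then A $ fst h else - \<sigma> (fst h) * A $ fst h)"

text \<open>
  The column of \<open>B_bc G \<sigma>\<close> at \<open>e\<close>; for a loop the two unit vectors combine to the entry \<open>1 - \<sigma> e\<close>.
\<close>

definition boundary ::
    "('v::finite, 'e) pre_digraph \<Rightarrow> ('e \<Rightarrow> real) \<Rightarrow> 'e \<Rightarrow> real ^ 'v" where
  "boundary G \<sigma> e = axis (tail G e) 1 - \<sigma> e *\<^sub>R axis (head G e) 1"

lemma sum_half_edges:
  fixes f :: "'e::finite \<times> bool \<Rightarrow> 'a::comm_monoid_add"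
  shows "(\<Sum>h\<in>UNIV. f h) = (\<Sum>e\<in>UNIV. f (e, True) + f (e, False))"
proof -
  have "(\<Sum>h\<in>UNIV. f h) = (\<Sum>e\<in>UNIV. \<Sum>b\<in>UNIV. f (e, b))"
    by (simp add: UNIV_Times_UNIV[symmetric] sum.cartesian_product del: UNIV_Times_UNIV)
  then show ?thesis
    by (simp add: UNIV_bool add.commute)
qed

lemma sum_star:
  fixes G :: "('v::finite, 'e::finite) pre_digraph" and f :: "'e \<times> bool \<Rightarrow> 'a::comm_monoid_add"
  shows "(\<Sum>h\<in>star G v. f h) =
    (\<Sum>e\<in>{e. tail G e = v}. f (e, True)) + (\<Sum>e\<in>{e. head G e = v}. f (e, False))"
proof -
  have "(\<Sum>h\<in>star G v. f h) = (\<Sum>h\<in>UNIV. if origin G h = v then f h else 0)"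
    unfolding star_def by (simp add: sum.If_cases)
  then show ?thesis
    by (simp add: sum_half_edges origin_def sum.distrib sum.If_cases)
qed

lemma sum_over_stars:
  fixes G :: "('v::finite, 'e::finite) pre_digraph" and f :: "'e \<times> bool \<Rightarrow> 'a::comm_monoid_add"
  shows "(\<Sum>v\<in>UNIV. \<Sum>h\<in>star G v. f h) = (\<Sum>h\<in>UNIV. f h)"
  unfolding star_def using sum.group[of UNIV UNIV "origin G" f] by simp

lemma boundary_component:
  "boundary G \<sigma> e $ v =
    (if tail G e = v then 1 else 0) - \<sigma> e * (if head G e = v then 1 else 0)"
  by (auto simp: boundary_def axis_def)

lemma B_bc_mult: "B_bc G \<sigma> *v A = (\<Sum>e\<in>UNIV. A $ e *\<^sub>R boundary G \<sigma> e)"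
  by (auto simp: vec_eq_iff matrix_vector_mult_def B_bc_def boundary_component intro!: sum.cong)

lemma ker_bc_iff_balanced: "A \<in> ker_bc G \<sigma> \<longleftrightarrow> balanced G (outflow \<sigma> A)"
proof -
  have "(\<Sum>h\<in>star G v. outflow \<sigma> A h) = (\<Sum>e\<in>UNIV. A $ e * boundary G \<sigma> e $ v)" for v
  proof -
    have "(\<Sum>e\<in>UNIV. A $ e * boundary G \<sigma> e $ v)
        = (\<Sum>e\<in>UNIV. (if tail G e = v then A $ e else 0) + (if head G e = v then - \<sigma> e * A $ e else 0))"
      by (intro sum.cong) (auto simp: boundary_component algebra_simps)
    then show ?thesis
      by (simp add: sum_star outflow_def sum.distrib sum.If_cases)
  qed
  then show ?thesis
    by (simp add: ker_bc_def B_bc_mult balanced_def vec_eq_iff)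
qed

lemma ker_bc_add: "A \<in> ker_bc G \<sigma> \<Longrightarrow> A' \<in> ker_bc G \<sigma> \<Longrightarrow> A + A' \<in> ker_bc G \<sigma>"
  and ker_bc_scale: "A \<in> ker_bc G \<sigma> \<Longrightarrow> c *\<^sub>R A \<in> ker_bc G \<sigma>"
  by (simp_all add: ker_bc_def matrix_vector_right_distrib matrix_vector_mult_scaleR)

lemma span_image_finite_explicit:
  fixes f :: "'a \<Rightarrow> 'b::real_vector"
  assumes "finite S" and "b \<in> span (f ` S)"
  obtains x where "b = (\<Sum>i\<in>S. x i *\<^sub>R f i)"
proof -
  have "subspace {b. \<exists>x. b = (\<Sum>i\<in>S. x i *\<^sub>R f i)}"
  proof (rule subspaceI; clarsimp)
    show "\<exists>x. (\<Sum>i\<in>S. x i *\<^sub>R f i) = 0" by (rule exI[of _ "\<lambda>_. 0"]) simp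
  next
    fix x y show "\<exists>z. (\<Sum>i\<in>S. x i *\<^sub>R f i) + (\<Sum>i\<in>S. y i *\<^sub>R f i) = (\<Sum>i\<in>S. z i *\<^sub>R f i)"
      by (rule exI[of _ "\<lambda>i. x i + y i"]) (simp add: scaleR_add_left sum.distrib)
  next
    fix c x show "\<exists>z. c *\<^sub>R (\<Sum>i\<in>S. x i *\<^sub>R f i) = (\<Sum>i\<in>S. z i *\<^sub>R f i)"
      by (rule exI[of _ "\<lambda>i. c * x i"]) (simp add: scaleR_sum_right)
  qed
  moreover have "f ` S \<subseteq> {b. \<exists>x. b = (\<Sum>i\<in>S. x i *\<^sub>R f i)}"
  proof clarify
    fix i assume "i \<in> S"
    then have "(\<Sum>j\<in>S. (if j = i then 1 else 0) *\<^sub>R f j) = f i"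
      using assms(1) by (simp add: if_distrib[of "\<lambda>c. c *\<^sub>R _"] cong: if_cong)
    then show "\<exists>x. f i = (\<Sum>i\<in>S. x i *\<^sub>R f i)"
      by (intro exI[of _ "\<lambda>j. if j = i then 1 else 0"]) simp
  qed
  ultimately show thesis
    using span_minimal[of "f ` S"] assms(2) that by blast
qed


section \<open>Connected graphs of first Betti number two\<close>

text \<open>
  The linear content of the statement that two edges are the chords of a spanning tree: the incidence
  columns of the other edges span all vectors with coordinate sum zero. In this form it can be obtained
  from a choice of basis as well as from a tree.
\<close>

definition cotree_pair :: "('v::finite, 'e) pre_digraph \<Rightarrow> 'e \<Rightarrow> 'e \<Rightarrow> bool" where
  "cotree_pair G e1 e2 \<longleftrightarrow> e1 \<noteq> e2 \<and>
     {b. (\<Sum>v\<in>UNIV. b $ v) = 0} \<subseteq> span (boundary G (\<lambda>_. 1) ` (- {e1, e2}))"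

text \<open>
  The incidence columns along a walk telescope to the difference of its end vertices.
\<close>

lemma axis_diff_in_span:
  fixes T :: "('v::finite, 'e) pre_digraph"
  assumes "verts T = UNIV" and "Digraph_Component.connected T"
  shows "axis u 1 - axis w 1 \<in> span (boundary T (\<lambda>_. 1) ` arcs T)"
proof -
  have "u \<rightarrow>\<^sup>*\<^bsub>with_proj (mk_symmetric T)\<^esub> w"
    using assms by (simp add: connected_def strongly_connected_def)
  then have "(u, w) \<in> (arcs_ends (with_proj (mk_symmetric T)))\<^sup>*"
    by (rule reachable_rtranclI)
  then show ?thesis
  proof (induct rule: rtrancl_induct)
    case base
    show ?case by (simp add: span_zero)
  next
    case (step x y)
    then have "(x, y) \<in> parcs (mk_symmetric T)" by simp
    then obtain e where e: "e \<in> arcs T"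
      and "(x, y) = (tail T e, head T e) \<or> (x, y) = (head T e, tail T e)"
      by (auto simp: parcs_mk_symmetric)
    then have "axis x 1 - axis y 1 \<in> {boundary T (\<lambda>_. 1) e, - boundary T (\<lambda>_. 1) e}"
      by (auto simp: boundary_def)
    moreover have "boundary T (\<lambda>_. 1) e \<in> span (boundary T (\<lambda>_. 1) ` arcs T)"
      using e by (simp add: span_base)
    ultimately have "axis x 1 - axis y 1 \<in> span (boundary T (\<lambda>_. 1) ` arcs T)"
      using span_neg by fastforce
    from span_add[OF step(3) this] show ?case by simp
  qed
qed

lemma sum_zero_in_span:
  fixes T :: "('v::finite, 'e) pre_digraph"
  assumes "verts T = UNIV" and "Digraph_Component.connected T"
    and b: "(\<Sum>v\<in>UNIV. b $ v) = 0"
  shows "b \<in> span (boundary T (\<lambda>_. 1) ` arcs T)"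
proof -
  fix w :: 'v
  have "(\<Sum>v\<in>UNIV. b $ v *\<^sub>R (axis v 1 - axis w 1))
      = (\<Sum>v\<in>UNIV. b $ v *\<^sub>R axis v 1) - (\<Sum>v\<in>UNIV. b $ v) *\<^sub>R (axis w 1 :: real ^ 'v)"
    by (simp add: scaleR_diff_right sum_subtractf scaleR_sum_left)
  also have "\<dots> = b"
    using b basis_expansion[of b] by (simp add: scalar_mult_eq_scaleR)
  finally have "b = (\<Sum>v\<in>UNIV. b $ v *\<^sub>R (axis v 1 - axis w 1))" ..
  then show ?thesis
    by (metis (no_types, lifting) span_sum span_scale axis_diff_in_span[OF assms(1,2)])
qed

lemma spanning_tree_cotree_pair:
  fixes G T :: "('v::finite, 'e) pre_digraph"
  assumes "verts G = UNIV" and "arcs G = UNIV"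
    and "undirected_spanning_tree T G" and "e1 \<noteq> e2" and "arcs G - arcs T = {e1, e2}"
  shows "cotree_pair G e1 e2"
proof -
  have "arcs T = - {e1, e2}" "verts T = UNIV" "tail T = tail G" "head T = head G"
    and "Digraph_Component.connected T"
    using assms
    by (auto simp: undirected_spanning_tree_def spanning_def subgraph_def compatible_def)
  then show ?thesis
    using sum_zero_in_span[of T] \<open>e1 \<noteq> e2\<close>
    by (auto simp: cotree_pair_def boundary_def cong: image_cong)
qed

text \<open>
  Choose edges whose incidence columns form a basis of the hyperplane of coordinate sum zero. Its dimension
  is \<open>|V| - 1\<close>, so exactly two edges remain.
\<close>

lemma cotree_pair_exists:
  fixes G :: "('v::finite, 'e::finite) pre_digraph"
  assumes "verts G = UNIV" and "arcs G = UNIV"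
    and "Digraph_Component.connected G" and "CARD('e) = CARD('v) + 1"
  obtains e1 e2 where "cotree_pair G e1 e2"
proof -
  let ?c = "boundary G (\<lambda>_. 1)" and ?H = "{b :: real ^ 'v. (\<Sum>v\<in>UNIV. b $ v) = 0}"
  have H: "?H = {b. (\<chi> v. (1 :: real)) \<bullet> b = 0}"
    by (simp add: inner_vec_def)
  have "(\<chi> v. (1 :: real)) \<noteq> (0 :: real ^ 'v)" by (simp add: vec_eq_iff)
  then have dimH: "dim ?H = CARD('v) - 1"
    unfolding H by (subst dim_hyperplane) auto
  have sub: "?H \<subseteq> span (range ?c)"
    using sum_zero_in_span[OF assms(1,3)] assms(2) by auto
  have "range ?c \<subseteq> ?H"
    by (auto simp: boundary_component sum_subtractf)
  then have "dim (range ?c) = CARD('v) - 1"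
    using dimH dim_subset[of "range ?c" ?H] dim_subset[OF sub] by (simp add: dim_span)
  then obtain B where B: "B \<subseteq> range ?c" "range ?c \<subseteq> span B" "card B = CARD('v) - 1"
    using basis_exists[of "range ?c"] by metis
  obtain S where S: "inj_on ?c S" "B = ?c ` S"
    using B(1) by (metis subset_image_inj)
  have "card S = CARD('v) - 1" using S B(3) by (simp add: card_image)
  then have "card (- S) = 2"
    using assms(4) by (simp add: Compl_eq_Diff_UNIV card_Diff_subset Suc_diff_le)
  then obtain e1 e2 where e: "- S = {e1, e2}" "e1 \<noteq> e2" by (auto simp: card_2_iff)
  then have "S = - {e1, e2}" by auto
  then have "?H \<subseteq> span (?c ` (- {e1, e2}))"
    using sub B(2) S(2) span_mono[of "range ?c" "span B"] by (auto simp: span_span)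
  with e(2) show thesis by (intro that) (simp add: cotree_pair_def)
qed

text \<open>
  A chord with value \<open>a\<close> has total divergence \<open>(1 - \<sigma> e) a\<close>. When these totals cancel, the divergence of
  the two chords lies in the span of the other columns and can be compensated on the other edges.
\<close>

lemma flow_with_chord_values:
  fixes G :: "('v::finite, 'e::finite) pre_digraph"
  assumes "cotree_pair G e1 e2"
    and \<sigma>: "\<And>e. e \<notin> {e1, e2} \<Longrightarrow> \<sigma> e = 1"
    and a: "(1 - \<sigma> e1) * a1 + (1 - \<sigma> e2) * a2 = 0"
  obtains A where "A \<in> ker_bc G \<sigma>" "A $ e1 = a1" "A $ e2 = a2"
proof -
  define b where "b = - (a1 *\<^sub>R boundary G \<sigma> e1 + a2 *\<^sub>R boundary G \<sigma> e2)"
  have ne: "e1 \<noteq> e2" using assms(1) by (simp add: cotree_pair_def)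
  have div: "(\<Sum>v\<in>UNIV. boundary G \<sigma> e $ v) = 1 - \<sigma> e" for e
    by (simp add: boundary_component sum_subtractf sum_distrib_left[symmetric])
  have "(\<Sum>v\<in>UNIV. b $ v) = - (a1 * (\<Sum>v\<in>UNIV. boundary G \<sigma> e1 $ v)
      + a2 * (\<Sum>v\<in>UNIV. boundary G \<sigma> e2 $ v))"
    by (simp add: b_def sum_negf sum.distrib sum_distrib_left sum_subtractf)
  then have "(\<Sum>v\<in>UNIV. b $ v) = 0"
    unfolding div using a by (simp add: mult.commute)
  then have "b \<in> span (boundary G (\<lambda>_. 1) ` (- {e1, e2}))"
    using assms(1) by (auto simp: cotree_pair_def)
  then obtain x where x: "b = (\<Sum>e\<in>- {e1, e2}. x e *\<^sub>R boundary G (\<lambda>_. 1) e)"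
    using span_image_finite_explicit[of "- {e1, e2}" b] by auto
  define A :: "real ^ 'e" where "A = (\<chi> e. if e = e1 then a1 else if e = e2 then a2 else x e)"
  have "(\<Sum>e\<in>UNIV. A $ e *\<^sub>R boundary G \<sigma> e)
      = (\<Sum>e\<in>{e1, e2}. A $ e *\<^sub>R boundary G \<sigma> e) + (\<Sum>e\<in>- {e1, e2}. A $ e *\<^sub>R boundary G \<sigma> e)"
    by (subst sum.union_disjoint[symmetric]) (auto simp: Un_commute Compl_partition)
  also have "(\<Sum>e\<in>- {e1, e2}. A $ e *\<^sub>R boundary G \<sigma> e) = b"
    unfolding x by (intro sum.cong) (auto simp: A_def boundary_def \<sigma>)
  also have "(\<Sum>e\<in>{e1, e2}. A $ e *\<^sub>R boundary G \<sigma> e) = - b"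
    using ne by (simp add: A_def b_def)
  finally have "A \<in> ker_bc G \<sigma>" by (simp add: ker_bc_def B_bc_mult)
  then show thesis using ne by (intro that) (auto simp: A_def)
qed


section \<open>Edges in series\<close>

text \<open>
  Constancy on the classes of edges in series, where two edges are in series if they are linked by
  vertices of degree two. Stating constancy at each such vertex avoids constructing the classes: the
  level sets of an invariant function serve in their place.
\<close>

definition series_invariant :: "('v, 'e) pre_digraph \<Rightarrow> ('e \<Rightarrow> 'a) \<Rightarrow> bool" where
  "series_invariant G F \<longleftrightarrow>
     (\<forall>h h'. origin G h = origin G h' \<and> card (star G (origin G h)) = 2 \<longrightarrow> F (fst h) = F (fst h'))"

definition branch_halves :: "('v, 'e) pre_digraph \<Rightarrow> 'e set \<Rightarrow> ('e \<times> bool) set" where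
  "branch_halves G P = {h. fst h \<in> P \<and> card (star G (origin G h)) \<noteq> 2}"

lemma balanced_degree_two:
  fixes G :: "('v, 'e::finite) pre_digraph"
  assumes "balanced G f" and "origin G h = origin G h'" and "card (star G (origin G h)) = 2" "h \<noteq> h'"
  shows "f h' = - f h"
proof -
  have "star G (origin G h) = {h, h'}"
    using card_seteq[of "star G (origin G h)" "{h, h'}"] assms(2-4) by (auto simp: star_def)
  moreover have "(\<Sum>k\<in>star G (origin G h). f k) = 0"
    using assms(1) by (simp add: balanced_def)
  ultimately have "f h + f h' = 0"
    using assms(4) by simp
  then show ?thesis by simp
qed

lemma product_series_invariant:
  fixes G :: "('v, 'e::finite) pre_digraph"
  assumes "balanced G f" and "balanced G g" and F: "\<And>h. F (fst h) = f h * g h"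
  shows "series_invariant G F"
  unfolding series_invariant_def
proof (intro allI impI; elim conjE)
  fix h h' assume *: "origin G h = origin G h'" "card (star G (origin G h)) = 2"
  show "F (fst h) = F (fst h')"
    using balanced_degree_two[OF assms(1) *] balanced_degree_two[OF assms(2) *]
    by (cases "h = h'") (simp_all add: F)
qed

lemma series_invariantD:
  assumes "series_invariant G F" and "card (star G v) = 2" and "h \<in> star G v" "h' \<in> star G v"
  shows "F (fst h) = F (fst h')"
proof -
  have "origin G h = origin G h'" "card (star G (origin G h)) = 2"
    using assms(2-4) by (simp_all add: star_def)
  then show ?thesis
    using assms(1) unfolding series_invariant_def by blast
qed

text \<open>
  The edges in \<open>P\<close> have \<open>2 |P|\<close> half-edges, and a vertex of degree two carries none or both of its own.
\<close>

lemma even_branch_halves: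
  fixes G :: "('v::finite, 'e::finite) pre_digraph"
  assumes "series_invariant G (\<lambda>e. e \<in> P)"
  shows "even (card (branch_halves G P))"
proof -
  let ?N = "{h. fst h \<in> P \<and> card (star G (origin G h)) = 2}"
  have "card ?N = (\<Sum>v\<in>UNIV. card {h \<in> ?N. origin G h = v})"
    using sum.group[of ?N UNIV "origin G" "\<lambda>_. 1::nat"] by simp
  moreover have "even (card {h \<in> ?N. origin G h = v})" for v
  proof (cases "{h \<in> ?N. origin G h = v} = {}")
    case True
    then show ?thesis by (metis card.empty even_zero)
  next
    case False
    then obtain h where h: "h \<in> ?N" "origin G h = v" by blast
    then have "fst h' \<in> P" if "origin G h' = v" for h'
      using assms that unfolding series_invariant_def by (metis (mono_tags, lifting) mem_Collect_eq)
    with h have "{h \<in> ?N. origin G h = v} = star G v"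
      by (auto simp: star_def)
    then show ?thesis using h by simp
  qed
  ultimately have "even (card ?N)" by (simp add: dvd_sum)
  moreover have "card ?N + card (branch_halves G P) = card (P \<times> (UNIV :: bool set))"
  proof -
    have "?N \<union> branch_halves G P = P \<times> UNIV" "?N \<inter> branch_halves G P = {}"
      by (auto simp: branch_halves_def)
    then show ?thesis using card_Un_disjoint[of ?N "branch_halves G P"] by simp
  qed
  ultimately show ?thesis by (simp add: card_cartesian_product) presburger
qed

locale bicyclic_graph =
  fixes G :: "('v::finite, 'e::finite) pre_digraph" and e1 e2 :: 'e
  assumes cotree: "cotree_pair G e1 e2"
    and degree_ge_2: "2 \<le> card (star G v)"
    and edge_count: "CARD('e) = CARD('v) + 1"
begin

text \<open>
  The handshake identity: \<open>2 |E| - 2 |V| = 2\<close>.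
\<close>

lemma degree_excess: "(\<Sum>v\<in>UNIV. card (star G v) - 2) = 2"
proof -
  have "(\<Sum>v\<in>UNIV. card (star G v)) = 2 * CARD('e)"
    using sum_over_stars[where G = G and f = "\<lambda>_. 1::nat"] by (simp add: sum_half_edges)
  moreover have "(\<Sum>v\<in>UNIV. card (star G v)) = (\<Sum>v\<in>UNIV. card (star G v) - 2) + 2 * CARD('v)"
  proof -
    have "(\<Sum>v\<in>UNIV. card (star G v)) = (\<Sum>v\<in>UNIV. (card (star G v) - 2) + 2)"
      by (intro sum.cong) (simp_all only: le_add_diff_inverse2[OF degree_ge_2])
    then show ?thesis by (simp only: sum.distrib) simp
  qed
  ultimately show ?thesis using edge_count by simp
qed

lemma branch_vertices:
  obtains (one) v where "card (star G v) = 4" "\<And>u. u \<noteq> v \<Longrightarrow> card (star G u) = 2"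
  | (two) v w where "v \<noteq> w" "card (star G v) = 3" "card (star G w) = 3"
      "\<And>u. u \<noteq> v \<Longrightarrow> u \<noteq> w \<Longrightarrow> card (star G u) = 2"
proof (cases "\<exists>v. card (star G v) - 2 \<ge> 2")
  case True
  then obtain v where v: "card (star G v) - 2 \<ge> 2" by blast
  have "(card (star G v) - 2) + (\<Sum>u\<in>UNIV - {v}. card (star G u) - 2) = 2"
    using degree_excess by (subst (asm) sum.remove[of _ v]) auto
  with v have "card (star G v) = 4" "(\<Sum>u\<in>UNIV - {v}. card (star G u) - 2) = 0"
    by linarith+
  with degree_ge_2 show thesis
    by (intro one) (auto simp: le_antisym)
next
  case False
  have deg: "card (star G v) - 2 = (if card (star G v) = 3 then 1 else 0)"
    "card (star G v) = 3 \<or> card (star G v) = 2" for v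
    using False[simplified, rule_format, of v] degree_ge_2[of v] by auto
  have "card {v. card (star G v) = 3} = 2"
    using degree_excess unfolding deg(1) by (simp add: sum.If_cases)
  then obtain v w where "{v. card (star G v) = 3} = {v, w}" "v \<noteq> w"
    by (auto simp: card_2_iff)
  with deg(2) show thesis
    by (intro two[of v w]) blast+
qed

text \<open>
  Otherwise the vertices on \<open>P\<close> all have degree two, so no edge leaves their set \<open>U\<close>. By connectivity \<open>U\<close>
  is the whole vertex set, and then no vertex has degree above two, against \<open>degree_excess\<close>.
\<close>

lemma branch_halves_nonempty:
  assumes P: "series_invariant G (\<lambda>e. e \<in> P)" and "P \<noteq> {}"
  shows "branch_halves G P \<noteq> {}"
proof
  assume "branch_halves G P = {}"
  then have two: "card (star G (origin G h)) = 2" if "fst h \<in> P" for h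
    using that unfolding branch_halves_def by blast
  define U where "U = {origin G h |h. fst h \<in> P}"
  have ends: "fst h \<in> P" if "origin G h \<in> U" for h
  proof -
    from that obtain h' where "fst h' \<in> P" "origin G h = origin G h'"
      unfolding U_def by blast
    then show ?thesis
      using P two[of h'] unfolding series_invariant_def by metis
  qed
  have "tail G e \<in> U \<longleftrightarrow> head G e \<in> U" for e
  proof -
    have "tail G e \<in> U \<and> head G e \<in> U" if "e \<in> P"
    proof -
      have "origin G (e, True) \<in> U" "origin G (e, False) \<in> U"
        unfolding U_def using that by (auto intro!: exI)
      then show ?thesis by (simp add: origin_def)
    qed
    moreover have "tail G e \<in> U \<Longrightarrow> e \<in> P" "head G e \<in> U \<Longrightarrow> e \<in> P"
      using ends[of "(e, True)"] ends[of "(e, False)"] by (simp_all add: origin_def)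
    ultimately show ?thesis by blast
  qed
  \<comment> \<open>Connectivity enters through the spanning property: the functional that sums over \<open>U\<close> kills every
      incidence column, hence every difference of two unit vectors.\<close>
  then have "boundary G (\<lambda>_. 1) ` (- {e1, e2}) \<subseteq> {b. (\<Sum>v\<in>U. b $ v) = 0}"
    by (auto simp: boundary_component sum_subtractf)
  moreover have "subspace {b :: real ^ 'v. (\<Sum>v\<in>U. b $ v) = 0}"
    by (rule subspaceI) (auto simp: sum.distrib sum_distrib_left[symmetric])
  ultimately have zero: "(\<Sum>v\<in>U. b $ v) = 0" if "(\<Sum>v\<in>UNIV. b $ v) = 0" for b :: "real ^ 'v"
    using cotree span_minimal that unfolding cotree_pair_def by blast
  obtain e where "e \<in> P" using \<open>P \<noteq> {}\<close> by blast
  then have "origin G (e, True) \<in> U" unfolding U_def by (auto intro!: exI)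
  then have u: "tail G e \<in> U" by (simp add: origin_def)
  have all: "w \<in> U" for w
    using zero[of "axis (tail G e) 1 - axis w 1"] u
    by (auto simp: axis_def sum_subtractf split: if_splits)
  have "card (star G w) = 2" for w
  proof -
    from all[of w] obtain h where "fst h \<in> P" "w = origin G h" unfolding U_def by blast
    then show ?thesis using two by simp
  qed
  with degree_excess show False by simp
qed

lemma branch_halves_ge_2:
  assumes "series_invariant G (\<lambda>e. e \<in> P)" and "P \<noteq> {}"
  shows "2 \<le> card (branch_halves G P)"
proof -
  have "card (branch_halves G P) \<noteq> 0"
    using branch_halves_nonempty[OF assms] by simp
  moreover have "even (card (branch_halves G P))"
    by (rule even_branch_halves[OF assms(1)])
  ultimately show ?thesis
    by (metis One_nat_def even_numeral less_2_cases not_less odd_one)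
qed

text \<open>
  Three level sets take at least two branch half-edges each. This exceeds four, so there are two branch
  vertices of degree three, and exhausts six, so each level set has exactly two and there is no fourth.
\<close>

lemma three_series_classes:
  assumes F: "series_invariant G F" and ne: "F a \<noteq> F b" "F a \<noteq> F c" "F b \<noteq> F c"
  obtains v w where "v \<noteq> w" "card (star G v) = 3" "card (star G w) = 3"
    "\<And>u. u \<noteq> v \<Longrightarrow> u \<noteq> w \<Longrightarrow> card (star G u) = 2"
    "\<And>e. F e = F a \<or> F e = F b \<or> F e = F c"
    "\<And>x. x \<in> {a, b, c} \<Longrightarrow>
       card {h \<in> star G v. F (fst h) = F x} + card {h \<in> star G w. F (fst h) = F x} = 2"
proof -
  define H where "H x = branch_halves G {e. F e = F x}" for x
  define R where "R = {e. F e \<notin> {F a, F b, F c}}"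
  have H2: "2 \<le> card (H x)" for x
    unfolding H_def using F by (intro branch_halves_ge_2) (auto simp: series_invariant_def)
  have R2: "2 \<le> card (branch_halves G R)" if "R \<noteq> {}"
    using F that by (intro branch_halves_ge_2) (auto simp: series_invariant_def R_def)
  have "branch_halves G UNIV = H a \<union> (H b \<union> (H c \<union> branch_halves G R))"
    by (auto simp: H_def R_def branch_halves_def)
  moreover have disjH: "H a \<inter> H b = {}" "H a \<inter> H c = {}" "H b \<inter> H c = {}"
    "H a \<inter> branch_halves G R = {}" "H b \<inter> branch_halves G R = {}" "H c \<inter> branch_halves G R = {}"
    using ne by (auto simp: H_def R_def branch_halves_def)
  ultimately have total: "card (branch_halves G UNIV) = card (H a) + card (H b) + card (H c) + card (branch_halves G R)"
    using disjH by (simp add: card_Un_disjoint Int_Un_distrib)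
  show thesis
  proof (cases rule: branch_vertices)
    case (one v)
    then have "branch_halves G UNIV \<subseteq> star G v"
      by (auto simp: branch_halves_def star_def)
    then have "card (branch_halves G UNIV) \<le> 4"
      using one(1) card_mono[of "star G v"] by (metis finite)
    with total H2[of a] H2[of b] H2[of c] show thesis by linarith
  next
    case (two v w)
    have "branch_halves G UNIV = star G v \<union> star G w"
      using two by (auto simp: branch_halves_def star_def)
    moreover have disj: "star G v \<inter> star G w = {}"
      using two(1) by (auto simp: star_def)
    ultimately have "card (branch_halves G UNIV) = 6"
      using two by (simp add: card_Un_disjoint)
    with total H2[of a] H2[of b] H2[of c] R2
    have c2: "card (H a) = 2" "card (H b) = 2" "card (H c) = 2" and "R = {}"
      by (linarith, linarith, linarith, linarith)
    have "H x = {h \<in> star G v. F (fst h) = F x} \<union> {h \<in> star G w. F (fst h) = F x}" for x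
      using two by (auto simp: H_def branch_halves_def star_def)
    then have "card (H x) = card {h \<in> star G v. F (fst h) = F x} + card {h \<in> star G w. F (fst h) = F x}" for x
      using disj by (simp, subst card_Un_disjoint) auto
    with two \<open>R = {}\<close> c2 show thesis
      by (intro that[of v w]) (auto simp: R_def)
  qed
qed


section \<open>Decomposition of balanced energies\<close>

lemma joint_parity_one: "joint_parity a b 1 1 = (\<lambda>_. 1)"
  by (auto simp: joint_parity_def)

lemma outflow_square:
  assumes "(\<sigma> (fst h))\<^sup>2 = 1"
  shows "(outflow \<sigma> A h)\<^sup>2 = (A $ fst h)\<^sup>2"
  using assms by (auto simp: outflow_def power_mult_distrib)

definition closure_sector_kernels :: "(real ^ 'e) set" where
  "closure_sector_kernels =
     (\<Union>\<epsilon>1\<in>{1, -1}. \<Union>\<epsilon>2\<in>{1, -1}. ker_bc G (joint_parity e1 e2 \<epsilon>1 \<epsilon>2))"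

text \<open>
  Think of \<open>F\<close> as labelling the series classes, of \<open>x\<close> as the branch vertex on the loop through \<open>e1\<close>, and
  of \<open>k\<close> as the half-edge at \<open>x\<close> on the bridge. If \<open>D\<close> vanished on the bridge, its restriction to the class
  of \<open>e1\<close> would still be balanced at every vertex. But in the sector \<open>(-1, -1)\<close> the chord \<open>e1\<close> flows out at both
  ends, which gives the restriction the total divergence \<open>2 D\<^sub>e\<^sub>1 \<noteq> 0\<close>.
\<close>

lemma dumbbell_bridge_flow_nonzero:
  fixes F :: "'e \<Rightarrow> 'a"
  defines "\<sigma> \<equiv> joint_parity e1 e2 (-1) (-1)"
  assumes D: "D \<in> ker_bc G \<sigma>" "D $ e1 \<noteq> 0"
    and F: "series_invariant G F" "F e2 \<noteq> F e1"
    and deg: "\<And>u. u \<noteq> x \<Longrightarrow> u \<noteq> y \<Longrightarrow> card (star G u) = 2"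
    and x: "k \<in> star G x" "F (fst k) \<noteq> F e1"
      "\<And>h. h \<in> star G x \<Longrightarrow> h \<noteq> k \<Longrightarrow> F (fst h) = F e1"
    and y: "\<And>h. h \<in> star G y \<Longrightarrow> F (fst h) \<noteq> F e1"
  shows "outflow \<sigma> D k \<noteq> 0"
proof
  assume k0: "outflow \<sigma> D k = 0"
  define g where "g h = (if F (fst h) = F e1 then outflow \<sigma> D h else 0)" for h
  have bal: "(\<Sum>h\<in>star G u. outflow \<sigma> D h) = 0" for u
    using D(1) by (simp add: ker_bc_iff_balanced balanced_def)
  have "(\<Sum>h\<in>star G u. g h) = 0" for u
  proof (cases "\<forall>h\<in>star G u. F (fst h) \<noteq> F e1")
    case True
    then show ?thesis by (intro sum.neutral) (simp add: g_def)
  next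
    case False
    have "g h = outflow \<sigma> D h" if "h \<in> star G u" for h
    proof (cases "u = x")
      case True
      then show ?thesis using x(3)[of h] that k0 by (cases "h = k") (auto simp: g_def)
    next
      case neq: False
      with False y have "card (star G u) = 2" by (intro deg) auto
      moreover obtain h0 where "h0 \<in> star G u" "F (fst h0) = F e1" using False by blast
      ultimately have "F (fst h) = F e1"
        using series_invariantD[OF F(1) _ \<open>h \<in> star G u\<close>] by metis
      then show ?thesis by (simp add: g_def)
    qed
    then show ?thesis using bal[of u] by simp
  qed
  then have "0 = (\<Sum>h\<in>UNIV. g h)"
    using sum_over_stars[where G = G and f = g] by simp
  also have "\<dots> = (\<Sum>e\<in>UNIV. if e = e1 then 2 * D $ e1 else 0)"
    unfolding sum_half_edges
    using F(2) by (intro sum.cong) (auto simp: g_def outflow_def \<sigma>_def joint_parity_def)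
  finally show False using D(2) by simp
qed

text \<open>
  Energies and products of flows are series invariant, so the identity is checked on the two chords and on
  an edge of the remaining class. The cases differ in how the branch vertices meet the three classes.
\<close>

theorem balanced_energy_decomposition:
  assumes p: "balanced G p" and r: "\<And>h. r $ fst h = (\<phi> $ origin G h)\<^sup>2 + (p h)\<^sup>2"
  shows "\<exists>As. set As \<subseteq> closure_sector_kernels \<and> r = (\<Sum>A\<leftarrow>As. sq A)"
proof -
  let ?\<sigma> = "joint_parity e1 e2 (-1) (-1)"
  have ne: "e1 \<noteq> e2" using cotree by (simp add: cotree_pair_def)
  obtain A1 where A1: "A1 \<in> ker_bc G (\<lambda>_. 1)" "A1 $ e1 = 1" "A1 $ e2 = 0"
    using flow_with_chord_values[OF cotree, of "\<lambda>_. 1" 1 0] by auto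
  obtain A2 where A2: "A2 \<in> ker_bc G (\<lambda>_. 1)" "A2 $ e1 = 0" "A2 $ e2 = 1"
    using flow_with_chord_values[OF cotree, of "\<lambda>_. 1" 0 1] by auto
  obtain D where D: "D \<in> ker_bc G ?\<sigma>" "D $ e1 = 1" "D $ e2 = -1"
    by (rule flow_with_chord_values[OF cotree, of ?\<sigma> 1 "-1"]) (auto simp: joint_parity_def)
  have plus: "x *\<^sub>R A1 + y *\<^sub>R A2 \<in> closure_sector_kernels" for x y
    unfolding closure_sector_kernels_def
    using ker_bc_add[OF ker_bc_scale[OF A1(1)] ker_bc_scale[OF A2(1)], of x y]
    by (simp add: joint_parity_one)
  have minus: "x *\<^sub>R D \<in> closure_sector_kernels" for x
    unfolding closure_sector_kernels_def using ker_bc_scale[OF D(1), of x] by force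
  define f1 f2 fD where "f1 = outflow (\<lambda>_. 1) A1" and "f2 = outflow (\<lambda>_. 1) A2"
    and "fD = outflow ?\<sigma> D"
  have bal: "balanced G f1" "balanced G f2" "balanced G fD"
    using A1(1) A2(1) D(1) by (simp_all add: f1_def f2_def fD_def ker_bc_iff_balanced)
  have sqr: "(A1 $ fst h)\<^sup>2 = (f1 h)\<^sup>2" "(A2 $ fst h)\<^sup>2 = (f2 h)\<^sup>2" "(D $ fst h)\<^sup>2 = (fD h)\<^sup>2" for h
    by (simp_all add: f1_def f2_def fD_def outflow_square joint_parity_def)
  have prod: "A1 $ fst h * A2 $ fst h = f1 h * f2 h" for h
    by (simp add: f1_def f2_def outflow_def)
  \<comment> \<open>All the quantities to be compared, collected so that edges with equal \<open>F\<close> need no further distinction.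
      The product records the relative sign of the two flows.\<close>
  define F where "F e = (r $ e, (A1 $ e)\<^sup>2, (A2 $ e)\<^sup>2, A1 $ e * A2 $ e, (D $ e)\<^sup>2)" for e
  have "series_invariant G (\<lambda>e. (A1 $ e)\<^sup>2)" "series_invariant G (\<lambda>e. (A2 $ e)\<^sup>2)"
    "series_invariant G (\<lambda>e. A1 $ e * A2 $ e)" "series_invariant G (\<lambda>e. (D $ e)\<^sup>2)"
    using product_series_invariant[OF bal(1) bal(1)] product_series_invariant[OF bal(2) bal(2)]
      product_series_invariant[OF bal(1) bal(2)] product_series_invariant[OF bal(3) bal(3)]
    by (auto simp: sqr prod power2_eq_square[symmetric])
  moreover have "series_invariant G (\<lambda>e. r $ e)"
    unfolding series_invariant_def
  proof (intro allI impI; elim conjE)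
    fix h h' assume *: "origin G h = origin G h'" "card (star G (origin G h)) = 2"
    show "r $ fst h = r $ fst h'"
      using balanced_degree_two[OF p *] * by (cases "h = h'") (simp_all add: r)
  qed
  ultimately have inv: "series_invariant G F"
    unfolding series_invariant_def F_def by blast
  have F12: "F e1 \<noteq> F e2" by (simp add: F_def A1 A2)
  have r0: "0 \<le> r $ e" for e using r[of "(e, True)"] by simp
  show ?thesis
  proof (cases "\<exists>e3. F e3 \<noteq> F e1 \<and> F e3 \<noteq> F e2")
    case False
    \<comment> \<open>Every edge is like one of the chords, as in a figure eight.\<close>
    let ?As = "[sqrt (r $ e1) *\<^sub>R A1 + 0 *\<^sub>R A2, 0 *\<^sub>R A1 + sqrt (r $ e2) *\<^sub>R A2]"
    have eqn: "r $ e = r $ e1 * (A1 $ e)\<^sup>2 + r $ e2 * (A2 $ e)\<^sup>2" for e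
      using False A1 A2 by (cases "F e = F e1") (auto simp: F_def)
    have "r $ e = (\<Sum>A\<leftarrow>?As. sq A) $ e" for e
      unfolding eqn[of e] by (simp add: sq_def power_mult_distrib r0)
    then have "r = (\<Sum>A\<leftarrow>?As. sq A)"
      by (intro iffD2[OF vec_eq_iff] allI)
    moreover have "set ?As \<subseteq> closure_sector_kernels"
      using plus by (simp del: scaleR_zero_left)
    ultimately show ?thesis by blast
  next
    case True
    then obtain e3 where e3: "F e3 \<noteq> F e1" "F e3 \<noteq> F e2" by blast
    define S where "S c u = {h \<in> star G u. F (fst h) = F c}" for c u
    obtain v w where vw: "v \<noteq> w" "card (star G v) = 3" "card (star G w) = 3"
      and deg: "\<And>u. u \<noteq> v \<Longrightarrow> u \<noteq> w \<Longrightarrow> card (star G u) = 2"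
      and all: "\<And>e. F e = F e1 \<or> F e = F e2 \<or> F e = F e3"
      and two: "\<And>c. c \<in> {e1, e2, e3} \<Longrightarrow> card (S c v) + card (S c w) = 2"
      unfolding S_def
      by (rule three_series_classes[OF inv F12, of e3]) (use e3 in auto)
    have split: "star G u = S e1 u \<union> (S e2 u \<union> S e3 u)" for u
      using all by (auto simp: S_def)
    have disj: "S e1 u \<inter> S e2 u = {}" "S e1 u \<inter> S e3 u = {}" "S e2 u \<inter> S e3 u = {}" for u
      using F12 e3 by (auto simp: S_def)
    have sum_split: "(\<Sum>h\<in>star G u. f h) = sum f (S e1 u) + sum f (S e2 u) + sum f (S e3 u)"
      for u and f :: "'e \<times> bool \<Rightarrow> real"
      unfolding split[of u] using disj[of u]
      by (simp add: sum.union_disjoint Int_Un_distrib)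
    have card_split: "card (star G u) = card (S e1 u) + card (S e2 u) + card (S e3 u)" for u
      unfolding split[of u] using disj[of u]
      by (simp add: card_Un_disjoint Int_Un_distrib)
    have on1: "(f1 h)\<^sup>2 = 1" "f2 h = 0" "(fD h)\<^sup>2 = 1" "r $ fst h = r $ e1" if "h \<in> S e1 u" for h u
      using that A1 A2 D sqr[of h] by (auto simp: S_def F_def)
    have on2: "f1 h = 0" "(f2 h)\<^sup>2 = 1" "(fD h)\<^sup>2 = 1" "r $ fst h = r $ e2" if "h \<in> S e2 u" for h u
      using that A1 A2 D sqr[of h] by (auto simp: S_def F_def)
    have on3: "(A1 $ e3)\<^sup>2 = (f1 h)\<^sup>2" "(A2 $ e3)\<^sup>2 = (f2 h)\<^sup>2" "A1 $ e3 * A2 $ e3 = f1 h * f2 h"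
      "(D $ e3)\<^sup>2 = (fD h)\<^sup>2" "r $ e3 = r $ fst h" if "h \<in> S e3 u" for h u
      using that sqr[of h] prod[of h] by (auto simp: S_def F_def)
    \<comment> \<open>A branch vertex cannot miss the third class: it would meet one of the chord classes exactly once,
        and the flow \<open>A1\<close> or \<open>A2\<close> through that class would have nowhere to go.\<close>
    have only1: False if "card (S e1 u) = 1" "card (S e3 u) = 0" for u
    proof -
      from that(1) obtain h where h: "S e1 u = {h}" by (rule card_1_singletonE)
      have "S e3 u = {}" using that(2) by simp
      then have "f1 h = 0"
        using bal(1) sum_split[of f1 u] h on2(1) by (simp add: balanced_def)
      then show False using on1(1)[of h u] h by simp
    qed
    have only2: False if "card (S e2 u) = 1" "card (S e3 u) = 0" for u
    proof -
      from that(1) obtain h where h: "S e2 u = {h}" by (rule card_1_singletonE)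
      have "S e3 u = {}" using that(2) by simp
      then have "f2 h = 0"
        using bal(2) sum_split[of f2 u] h on1(2) by (simp add: balanced_def)
      then show False using on2(2)[of h u] h by simp
    qed
    have cards: "card (S e1 v) + card (S e2 v) + card (S e3 v) = 3"
      "card (S e1 w) + card (S e2 w) + card (S e3 w) = 3"
      "card (S e1 v) + card (S e1 w) = 2" "card (S e2 v) + card (S e2 w) = 2"
      "card (S e3 v) + card (S e3 w) = 2"
      using card_split vw(2,3) two by auto
    consider (theta) "card (S e1 v) = 1" "card (S e2 v) = 1" "card (S e3 v) = 1"
      | (dumbbell) x y where "{x, y} = {v, w}" "card (S e1 x) = 2" "card (S e2 x) = 0" "card (S e3 x) = 1"
        "card (S e1 y) = 0" "card (S e2 y) = 2" "card (S e3 y) = 1"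
    proof -
      have pos: "card (S e3 u) \<noteq> 0"
        if "card (S e1 u) + card (S e2 u) + card (S e3 u) = 3" "card (S e1 u) \<le> 2" "card (S e2 u) \<le> 2" for u
      proof
        assume 0: "card (S e3 u) = 0"
        with that have "card (S e1 u) = 1 \<or> card (S e2 u) = 1" by linarith
        with 0 only1[of u] only2[of u] show False by blast
      qed
      have "card (S e3 v) \<noteq> 0" "card (S e3 w) \<noteq> 0"
        using cards by (intro pos; linarith)+
      then have "card (S e3 v) = 1" using cards(5) by linarith
      then consider "card (S e1 v) = 0" | "card (S e1 v) = 1" | "card (S e1 v) = 2"
        using cards by linarith
      then show thesis
      proof cases
        case 1
        show thesis by (rule dumbbell[of w v]) (use 1 cards \<open>card (S e3 v) = 1\<close> in \<open>linarith | blast\<close>)+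
      next
        case 2
        show thesis by (rule theta) (use 2 cards \<open>card (S e3 v) = 1\<close> in linarith)+
      next
        case 3
        show thesis by (rule dumbbell[of v w]) (use 3 cards \<open>card (S e3 v) = 1\<close> in \<open>linarith | blast\<close>)+
      qed
    qed
    then show ?thesis
    proof cases
      case theta
      then obtain h1 h2 h3 where h: "S e1 v = {h1}" "S e2 v = {h2}" "S e3 v = {h3}"
        by (metis card_1_singletonE)
      then have hS: "h1 \<in> S e1 v" "h2 \<in> S e2 v" "h3 \<in> S e3 v"
        and o: "origin G h1 = v" "origin G h2 = v" "origin G h3 = v"
        by (auto simp: S_def star_def)
      have total: "f h1 + f h2 + f h3 = 0" if "balanced G f" for f
        using that sum_split[of f v] h by (simp add: balanced_def)
      have f3: "f1 h3 = - f1 h1" "f2 h3 = - f2 h2"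
        using total[OF bal(1)] total[OF bal(2)] on1[OF hS(1)] on2[OF hS(2)] by auto
      have p3: "p h3 = - (p h1 + p h2)" using total[OF p] by linarith
      have r1: "r $ e1 = (\<phi> $ v)\<^sup>2 + (p h1)\<^sup>2" and r2: "r $ e2 = (\<phi> $ v)\<^sup>2 + (p h2)\<^sup>2"
        and r3: "r $ e3 = (\<phi> $ v)\<^sup>2 + (p h1 + p h2)\<^sup>2"
        using r[of h1] r[of h2] r[of h3] on1(4)[OF hS(1)] on2(4)[OF hS(2)] on3(5)[OF hS(3)] o p3
        by (auto simp: power2_commute power2_eq_square algebra_simps)
      \<comment> \<open>The flow with outflows \<open>x\<close>, \<open>y\<close>, \<open>- (x + y)\<close> at the three half-edges of \<open>v\<close>.\<close>
      define W where "W x y = (f1 h1 * x) *\<^sub>R A1 + (f2 h2 * y) *\<^sub>R A2" for x y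
      have W: "(W x y $ e)\<^sup>2 = x\<^sup>2 * (A1 $ e)\<^sup>2 + y\<^sup>2 * (A2 $ e)\<^sup>2 + 2 * x * y * (f1 h1 * f2 h2) * (A1 $ e * A2 $ e)" for x y e
      proof -
        have "(W x y $ e)\<^sup>2 = (f1 h1)\<^sup>2 * x\<^sup>2 * (A1 $ e)\<^sup>2 + (f2 h2)\<^sup>2 * y\<^sup>2 * (A2 $ e)\<^sup>2 + 2 * x * y * (f1 h1 * f2 h2) * (A1 $ e * A2 $ e)"
          by (simp add: W_def power2_eq_square algebra_simps)
        then show ?thesis using on1(1)[OF hS(1)] on2(2)[OF hS(2)] by simp
      qed
      have W1: "(W x y $ e)\<^sup>2 = x\<^sup>2" if "F e = F e1" for x y e
        using that unfolding W by (simp add: F_def A1 A2)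
      have W2: "(W x y $ e)\<^sup>2 = y\<^sup>2" if "F e = F e2" for x y e
        using that unfolding W by (simp add: F_def A1 A2)
      have W3: "(W x y $ e)\<^sup>2 = (x + y)\<^sup>2" if "F e = F e3" for x y e
      proof -
        have "(A1 $ e)\<^sup>2 = 1" "(A2 $ e)\<^sup>2 = 1" "A1 $ e * A2 $ e = f1 h1 * f2 h2"
          using that on3[OF hS(3)] f3 on1(1)[OF hS(1)] on2(2)[OF hS(2)] by (auto simp: F_def)
        moreover have "(f1 h1 * f2 h2) * (f1 h1 * f2 h2) = 1"
          using on1(1)[OF hS(1)] on2(2)[OF hS(2)] by (metis mult_1 power2_eq_square power_mult_distrib)
        ultimately show ?thesis unfolding W by (simp add: power2_sum mult.assoc)
      qed
      \<comment> \<open>The last two flows carry \<open>\<phi>\<^sup>2 (1, 1, 1) = \<phi>\<^sup>2 (1, 1/4, 1/4) + \<phi>\<^sup>2 (0, 3/4, 3/4)\<close>.\<close>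
      let ?As = "[W (p h1) (p h2), W (\<phi> $ v) (- (\<phi> $ v) / 2), W 0 (sqrt 3 / 2 * \<phi> $ v)]"
      have "r $ e = (\<Sum>A\<leftarrow>?As. sq A) $ e" for e
        using all[of e]
      proof (elim disjE)
        assume "F e = F e1"
        moreover from this have "r $ e = r $ e1" by (simp add: F_def)
        ultimately show ?thesis by (simp add: sq_def W1 r1)
      next
        assume "F e = F e2"
        moreover from this have "r $ e = r $ e2" by (simp add: F_def)
        ultimately show ?thesis by (simp add: sq_def W2 r2 power_mult_distrib power_divide)
      next
        assume "F e = F e3"
        moreover from this have "r $ e = r $ e3" by (simp add: F_def)
        ultimately show ?thesis
          by (simp add: sq_def W3 r3 power_mult_distrib power_divide)
      qed
      then have "r = (\<Sum>A\<leftarrow>?As. sq A)"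
        by (intro iffD2[OF vec_eq_iff] allI)
      moreover have "W x y \<in> closure_sector_kernels" for x y unfolding W_def by (rule plus)
      then have "set ?As \<subseteq> closure_sector_kernels" by simp
      ultimately show ?thesis by blast
    next
      case (dumbbell x y)
      obtain h h' where hh: "S e1 x = {h, h'}" "h \<noteq> h'" using dumbbell by (metis card_2_iff)
      obtain k where k: "S e3 x = {k}" using dumbbell by (metis card_1_singletonE)
      obtain i i' where ii: "S e2 y = {i, i'}" "i \<noteq> i'" using dumbbell by (metis card_2_iff)
      obtain l where l: "S e3 y = {l}" using dumbbell by (metis card_1_singletonE)
      have empty: "S e2 x = {}" "S e1 y = {}" using dumbbell by simp_all
      have totalx: "f k = - (f h + f h')" if "balanced G f" for f
        using that sum_split[of f x] hh k empty by (simp add: balanced_def)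
      have totaly: "f l = - (f i + f i')" if "balanced G f" for f
        using that sum_split[of f y] ii l empty by (simp add: balanced_def)
      have A1_0: "A1 $ e3 = 0" using totaly[OF bal(1)] on2(1)[of _ y] on3(1)[of l y] ii l by simp
      have A2_0: "A2 $ e3 = 0" using totalx[OF bal(2)] on1(2)[of _ x] on3(2)[of k x] hh k by simp
      have "fD k \<noteq> 0"
        unfolding fD_def
      proof (rule dumbbell_bridge_flow_nonzero[where F = F and x = x and y = y])
        show "card (star G u) = 2" if "u \<noteq> x" "u \<noteq> y" for u
          using that deg[of u] dumbbell(1) by (auto simp: doubleton_eq_iff)
        have "k \<in> S e3 x" using k by simp
        then show "k \<in> star G x" "F (fst k) \<noteq> F e1" using e3 by (simp_all add: S_def)
        show "F (fst h) = F e1" if "h \<in> star G x" "h \<noteq> k" for h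
        proof -
          have "h \<in> S e1 x" using that split[of x] empty(1) k by blast
          then show ?thesis by (simp add: S_def)
        qed
        show "F (fst h) \<noteq> F e1" if "h \<in> star G y" for h
        proof
          assume "F (fst h) = F e1"
          with that have "h \<in> S e1 y" by (simp add: S_def)
          with empty(2) show False by blast
        qed
      qed (use D inv F12 in auto)
      moreover have "fD h = 1 \<or> fD h = -1" "fD h' = 1 \<or> fD h' = -1"
        using on1(3)[of _ x] hh by (auto simp: power2_eq_1_iff)
      ultimately have D4: "(D $ e3)\<^sup>2 = 4"
        using totalx[OF bal(3)] on3(4)[of k x] k by auto
      \<comment> \<open>Here \<open>c\<close> is the energy on a loop, \<open>a\<close> and \<open>b\<close> are the derivatives at its two ends, and the left
          side is the energy on the bridge.\<close>
      have bound: "\<phi>' + (a + b)\<^sup>2 \<le> 4 * c" if "c = \<phi>' + a\<^sup>2" "c = \<phi>' + b\<^sup>2" "0 \<le> \<phi>'" for a b c \<phi>' :: real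
      proof -
        have "(a + b)\<^sup>2 \<le> 2 * a\<^sup>2 + 2 * b\<^sup>2"
          using sum_squares_bound[of a b] by (simp add: power2_sum)
        then show ?thesis using that by linarith
      qed
      have "r $ e3 \<le> 4 * r $ e1"
      proof -
        have "origin G h = x" "origin G h' = x" "origin G k = x" "h \<in> S e1 x" "h' \<in> S e1 x" "k \<in> S e3 x"
          using hh k by (auto simp: S_def star_def)
        then have "r $ e1 = (\<phi> $ x)\<^sup>2 + (p h)\<^sup>2" "r $ e1 = (\<phi> $ x)\<^sup>2 + (p h')\<^sup>2"
          "r $ e3 = (\<phi> $ x)\<^sup>2 + (p k)\<^sup>2"
          using r[of h] r[of h'] r[of k] on1(4) on3(5) by metis+
        moreover have "(p k)\<^sup>2 = (p h + p h')\<^sup>2"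
          unfolding totalx[OF p] by (rule power2_minus)
        ultimately show ?thesis
          using bound[of "r $ e1" "(\<phi> $ x)\<^sup>2" "p h" "p h'"] by simp
      qed
      moreover have "r $ e3 \<le> 4 * r $ e2"
      proof -
        have "origin G i = y" "origin G i' = y" "origin G l = y" "i \<in> S e2 y" "i' \<in> S e2 y" "l \<in> S e3 y"
          using ii l by (auto simp: S_def star_def)
        then have "r $ e2 = (\<phi> $ y)\<^sup>2 + (p i)\<^sup>2" "r $ e2 = (\<phi> $ y)\<^sup>2 + (p i')\<^sup>2"
          "r $ e3 = (\<phi> $ y)\<^sup>2 + (p l)\<^sup>2"
          using r[of i] r[of i'] r[of l] on2(4) on3(5) by metis+
        moreover have "(p l)\<^sup>2 = (p i + p i')\<^sup>2"
          unfolding totaly[OF p] by (rule power2_minus)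
        ultimately show ?thesis
          using bound[of "r $ e2" "(\<phi> $ y)\<^sup>2" "p i" "p i'"] by simp
      qed
      ultimately have nonneg: "0 \<le> r $ e1 - r $ e3 / 4" "0 \<le> r $ e2 - r $ e3 / 4" "0 \<le> r $ e3 / 4"
        using r0[of e3] by linarith+
      let ?As = "[sqrt (r $ e3 / 4) *\<^sub>R D, sqrt (r $ e1 - r $ e3 / 4) *\<^sub>R A1 + 0 *\<^sub>R A2,
        0 *\<^sub>R A1 + sqrt (r $ e2 - r $ e3 / 4) *\<^sub>R A2]"
      have eqn: "r $ e = r $ e3 / 4 * (D $ e)\<^sup>2 + ((r $ e1 - r $ e3 / 4) * (A1 $ e)\<^sup>2 + (r $ e2 - r $ e3 / 4) * (A2 $ e)\<^sup>2)" for e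
        using all[of e] A1 A2 D D4 A1_0 A2_0 by (auto simp: F_def)
      have "r $ e = (\<Sum>A\<leftarrow>?As. sq A) $ e" for e
        unfolding eqn[of e] using nonneg
        by (simp add: sq_def power_mult_distrib real_sqrt_pow2 del: real_sqrt_divide)
      then have "r = (\<Sum>A\<leftarrow>?As. sq A)"
        by (intro iffD2[OF vec_eq_iff] allI)
      moreover have "set ?As \<subseteq> closure_sector_kernels"
        using plus minus by (simp del: scaleR_zero_left)
      ultimately show ?thesis by blast
    qed
  qed
qed

end


section \<open>The singular cone bound\<close>

lemma finite_sectors: "finite (sectors :: ('e::finite \<Rightarrow> real) set)"
proof -
  have eq: "(sectors :: ('e \<Rightarrow> real) set) = (UNIV :: 'e set) \<rightarrow>\<^sub>E {1, -1 :: real}"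
    by (auto simp: sectors_def PiE_def)
  show ?thesis
    unfolding eq by (intro finite_PiE) auto
qed

lemma inner_sq: "a \<bullet> sq A = (\<Sum>e\<in>UNIV. a $ e * (A $ e)\<^sup>2)"
  by (simp add: inner_vec_def sq_def)

lemma C_sing_bounds_sector_vector:
  fixes \<alpha> len :: "real ^ 'e::finite"
  assumes "\<forall>e. 0 < len $ e" and "\<forall>e. 0 \<le> \<alpha> $ e"
    and \<sigma>: "\<sigma> \<in> sectors" and A: "A \<in> ker_bc G \<sigma>"
  shows "C_sing G \<alpha> len * (len \<bullet> sq A) \<le> \<alpha> \<bullet> sq A"
proof (cases "A = 0")
  case True
  then show ?thesis by (simp add: inner_sq)
next
  case False
  define q where "q B = (\<Sum>e\<in>UNIV. \<alpha> $ e * (B $ e)\<^sup>2) / (\<Sum>e\<in>UNIV. len $ e * (B $ e)\<^sup>2)" for B :: "real ^ 'e"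
  have "0 \<le> q B" for B
    unfolding q_def using assms(1,2)
    by (intro divide_nonneg_nonneg sum_nonneg mult_nonneg_nonneg) (auto simp: less_imp_le)
  then have "bdd_below (q ` (ker_bc G \<sigma> - {0}))" by (auto intro!: bdd_belowI2[of _ 0])
  moreover have "C_sing G \<alpha> len \<le> (INF B\<in>ker_bc G \<sigma> - {0}. q B)"
    unfolding C_sing_def q_def using \<sigma> A False
    by (intro Min_le finite_imageI finite_subset[OF _ finite_sectors]) auto
  ultimately have "C_sing G \<alpha> len \<le> q A"
    using A False by (meson DiffI cINF_lower order_trans singletonD)
  moreover obtain e where "A $ e \<noteq> 0" using False by (auto simp: vec_eq_iff)
  then have "0 < len \<bullet> sq A"
    unfolding inner_sq using assms(1)
    by (intro sum_pos2[of _ e]) (auto simp: less_imp_le)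
  ultimately show ?thesis
    by (simp add: q_def inner_sq pos_le_divide_eq)
qed

text \<open>
  The inequality defines a half-space, which is a convex cone; it contains the generators of \<open>M_bc G\<close>.
\<close>

lemma C_sing_bounds_M_bc:
  fixes \<alpha> len :: "real ^ 'e::finite"
  assumes "\<forall>e. 0 < len $ e" and "\<forall>e. 0 \<le> \<alpha> $ e" and "r \<in> M_bc G"
  shows "C_sing G \<alpha> len * (len \<bullet> r) \<le> \<alpha> \<bullet> r"
proof -
  let ?H = "{x. (\<alpha> - C_sing G \<alpha> len *\<^sub>R len) \<bullet> x \<ge> 0}"
  have "(\<Union>\<sigma>\<in>sectors. sq ` ker_bc G \<sigma>) \<subseteq> ?H"
    using C_sing_bounds_sector_vector[OF assms(1,2)] by (auto simp: inner_diff_left)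
  then have "M_bc G \<subseteq> ?H"
    unfolding M_bc_def by (intro hull_minimal convex_cone_halfspace_ge)
  with assms(3) show ?thesis by (auto simp: inner_diff_left)
qed


section \<open>Regular secular states\<close>

lemma vertex_degree_eq_card_star:
  fixes G :: "('v::finite, 'e::finite) pre_digraph"
  assumes "arcs G = UNIV"
  shows "vertex_degree G v = card (star G v)"
  using sum_star[where G = G and v = v and f = "\<lambda>_. 1 :: nat"] assms
  by (simp add: vertex_degree_def in_degree_def out_degree_def in_arcs_def out_arcs_def)

theorem theorem5p23:
  fixes G :: "('v::finite, 'e::finite) pre_digraph"
    and len \<theta> pt ph r :: "real ^ 'e"
    and \<phi> :: "real ^ 'v"
  assumes "verts G = UNIV" and "arcs G = UNIV"
    and "Digraph_Component.connected G"
    and "\<forall>v. vertex_degree G v \<ge> 2"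
    and "\<forall>e. len $ e > 0"
    and "betti1 G = 2"
    and "regular_secular_state G \<theta> \<phi> pt ph"
    and "r = edge_energy G \<phi> pt"
  shows "r \<in> M_bc G \<and>
    (\<forall>T e1 e2. undirected_spanning_tree T G \<and> e1 \<noteq> e2 \<and> arcs G - arcs T = {e1, e2} \<longrightarrow>
       (\<exists>(n::nat) (A :: nat \<Rightarrow> real ^ 'e).
          (\<forall>j<n. \<exists>\<epsilon>1\<in>{1, -1}. \<exists>\<epsilon>2\<in>{1, -1}. A j \<in> ker_bc G (joint_parity e1 e2 \<epsilon>1 \<epsilon>2)) \<and>
          r = (\<Sum>j<n. sq (A j)))) \<and>
    (\<forall>\<alpha> :: real ^ 'e. (\<forall>e. \<alpha> $ e \<ge> 0) \<longrightarrow> (\<alpha> \<bullet> r) / (len \<bullet> r) \<ge> C_sing G \<alpha> len)"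

proof -
  define p where "p h = (if snd h then pt $ fst h else ph $ fst h)" for h
  have bal: "balanced G p"
    using assms(2,7)
    by (simp add: balanced_def sum_star p_def regular_secular_state_def out_arcs_def in_arcs_def)
  have r: "r $ fst h = (\<phi> $ origin G h)\<^sup>2 + (p h)\<^sup>2" for h
    using edge_energy_head[OF assms(7), of "fst h"]
    by (cases "snd h") (simp_all add: assms(8) edge_energy_def origin_def p_def)
  have count: "CARD('e) = CARD('v) + 1"
    using assms(1,2,6) by (simp add: betti1_def)
  have decomposition: "\<exists>As. (\<forall>A\<in>set As. \<exists>\<epsilon>1\<in>{1, -1}. \<exists>\<epsilon>2\<in>{1, -1}. A \<in> ker_bc G (joint_parity e1 e2 \<epsilon>1 \<epsilon>2)) \<and>
      r = (\<Sum>A\<leftarrow>As. sq A)" if "cotree_pair G e1 e2" for e1 e2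
  proof -
    interpret bicyclic_graph G e1 e2
      using that count assms(2,4) by unfold_locales (simp_all add: vertex_degree_eq_card_star)
    show ?thesis
      using balanced_energy_decomposition[OF bal r]
      unfolding closure_sector_kernels_def subset_iff UN_iff Ball_def .
  qed
  have cone: "r \<in> M_bc G"
  proof -
    obtain e1 e2 where "cotree_pair G e1 e2"
      using cotree_pair_exists[OF assms(1-3) count] .
    then obtain As where As: "\<forall>A\<in>set As. \<exists>\<epsilon>1\<in>{1, -1}. \<exists>\<epsilon>2\<in>{1, -1}. A \<in> ker_bc G (joint_parity e1 e2 \<epsilon>1 \<epsilon>2)"
      and eq: "r = (\<Sum>A\<leftarrow>As. sq A)"
      using decomposition by blast
    have "sq A \<in> M_bc G" if "A \<in> set As" for A
    proof -
      from As that obtain \<epsilon>1 \<epsilon>2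
        where "\<epsilon>1 \<in> {1, -1}" "\<epsilon>2 \<in> {1, -1}" "A \<in> ker_bc G (joint_parity e1 e2 \<epsilon>1 \<epsilon>2)"
        by blast
      moreover from this have "joint_parity e1 e2 \<epsilon>1 \<epsilon>2 \<in> sectors"
        by (auto simp: sectors_def joint_parity_def)
      ultimately show ?thesis unfolding M_bc_def by (intro hull_inc) blast
    qed
    then have "(\<Sum>A\<leftarrow>As. sq A) \<in> M_bc G"
      by (induction As) (auto simp: M_bc_def convex_cone_hull_contains_0 convex_cone_hull_add)
    then show ?thesis using eq by simp
  qed
  moreover have "\<exists>(n::nat) (A :: nat \<Rightarrow> real ^ 'e).
      (\<forall>j<n. \<exists>\<epsilon>1\<in>{1, -1}. \<exists>\<epsilon>2\<in>{1, -1}. A j \<in> ker_bc G (joint_parity e1 e2 \<epsilon>1 \<epsilon>2)) \<and>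
      r = (\<Sum>j<n. sq (A j))"
    if "undirected_spanning_tree T G" "e1 \<noteq> e2" "arcs G - arcs T = {e1, e2}" for T e1 e2
  proof -
    from decomposition[OF spanning_tree_cotree_pair[OF assms(1,2) that]]
    obtain As where As: "\<forall>A\<in>set As. \<exists>\<epsilon>1\<in>{1, -1}. \<exists>\<epsilon>2\<in>{1, -1}. A \<in> ker_bc G (joint_parity e1 e2 \<epsilon>1 \<epsilon>2)"
      and eq: "r = (\<Sum>A\<leftarrow>As. sq A)"
      by blast
    have "r = (\<Sum>j<length As. sq (As ! j))"
      unfolding eq by (simp add: sum_list_sum_nth atLeast0LessThan)
    moreover have "\<forall>j<length As. \<exists>\<epsilon>1\<in>{1, -1}. \<exists>\<epsilon>2\<in>{1, -1}. As ! j \<in> ker_bc G (joint_parity e1 e2 \<epsilon>1 \<epsilon>2)"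
      using As nth_mem by blast
    ultimately show ?thesis by blast
  qed
  moreover have "C_sing G \<alpha> len \<le> (\<alpha> \<bullet> r) / (len \<bullet> r)" if "\<forall>e. 0 \<le> \<alpha> $ e" for \<alpha> :: "real ^ 'e"
  proof -
    have nonneg: "0 \<le> r $ e" for e
      using r[of "(e, True)"] by simp
    have "r \<noteq> 0"
    proof
      assume "r = 0"
      then have zero: "\<phi> $ origin G h = 0" "p h = 0" for h
        using r[of h] by (simp_all add: sum_power2_eq_zero_iff)
      have "pt = 0" "ph = 0"
        using zero(2)[of "(e, True)" for e] zero(2)[of "(e, False)" for e]
        by (auto simp: p_def vec_eq_iff)
      moreover have "\<phi> $ v = 0" for v
      proof -
        have "star G v \<noteq> {}"
          using assms(4) vertex_degree_eq_card_star[OF assms(2), of v] by (metis card.empty not_numeral_le_zero)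
        then show ?thesis using zero(1) by (auto simp: star_def)
      qed
      ultimately show False
        using assms(7) by (simp add: regular_secular_state_def vec_eq_iff)
    qed
    then obtain e where "r $ e \<noteq> 0" by (auto simp: vec_eq_iff)
    then have "0 < len \<bullet> r"
      unfolding inner_vec_def using assms(5) nonneg
      by (intro sum_pos2[of _ e]) (auto simp: less_imp_le order_less_le)
    then show ?thesis
      using C_sing_bounds_M_bc[OF assms(5) that cone] by (simp add: pos_le_divide_eq)
  qed
  ultimately show ?thesis by blast
qed

end
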